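(* Let $DB$ be an uncertain sequence database. For every sequential pattern $\alpha$ (of any length $m\ge 1$), $$expSup^{cap}(\alpha)\ \ge\ expSup(\alpha),$$ i.e. the quantity $expSup^{cap}$ of a sequential pattern is always greater than or equal to the actual expected support of that pattern.
   Context: Fix a finite, totally ordered (lexicographic) set of items $I$. A sequential pattern is a finite sequence $\alpha=\langle X_1,\dots,X_r\rangle$ of nonempty subsets of $I$ (itemsets, or events), each written in increasing item order; its length is $m=\sum_j|X_j|$. Listing the items of $\alpha$ in order as $i_1,\dots,i_m$, let $\alpha_k$ be the pattern formed by the first $k$ items ($\alpha_0$ empty). Thus $\alpha_k$ arises from $\alpha_{k-1}$ either by s-extension ($i_k$ is appended as a new event $\{i_k\}$) or by i-extension ($i_k$ is added to the last event of $\alpha_{k-1}$). An uncertain sequence is a finite sequence of itemsets $S=\langle e_1,\dots,e_n\rangle$ in which every item occurrence carries an existential probability in $(0,1]$. An uncertain sequence database $DB$ is a finite list of uncertain sequences. An occurrence of $\alpha$ in $S$ is a choice of indices $j_1<\dots<j_r$ with $X_l\subseteq e_{j_l}$ for all $l$; its probability is the product of the existential probabilities of the $m$ item occurrences used. $maxPr_S(\alpha)$ is the maximum of these probabilities over all occurrences of $\alpha$ in $S$ ($0$ if there are none), and $expSup(\alpha)=\sum_{S\in DB}maxPr_S(\alpha)$. Projected database: for a pattern $\beta$ with last event $X$, $DB|\beta$ consists, for each $S\in DB$ containing $\beta$, of the suffix of $S$ after the leftmost match of $\beta$: with $t$ minimal such that $\beta$ occurs in $\langle e_1,\dots,e_t\rangle$,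 the suffix consists of the items of $e_t$ that follow the last item of $\beta$, and the events $e_{t+1},\dots,e_n$ (with their probabilities). $DB|\alpha_0=DB$. An occurrence of an item $i$ in such a suffix is counted as an s-extension of $\beta$ if it lies in one of $e_{t+1},\dots,e_n$, and as an i-extension of $\beta$ if it lies in the remaining part of $e_t$, or in an event $e_j$, $j>t$, with $X\cup\{i\}\subseteq e_j$. When an item $i_k$ is considered in $DB|\alpha_{k-1}$, only occurrences of the extension type by which $\alpha_k$ arises from $\alpha_{k-1}$ are counted. $\widehat P_{DB|\alpha_{k-1}}(i_k)$ is the maximum probability of a counted occurrence of $i_k$ in $DB|\alpha_{k-1}$ ($0$ if none), and for $S\in DB|\alpha_{m-1}$, $maxPr_S(i_m)$ is the maximum probability of a counted occurrence of $i_m$ in that suffix ($0$ if none). Define $$maxPr(\alpha_k)=\prod_{l=1}^{k}\widehat P_{DB|\alpha_{l-1}}(i_l)\quad(maxPr(\alpha_0)=1),\qquad expSup^{cap}(\alpha)=maxPr(\alpha_{m-1})\times\sum_{S\in DB|\alpha_{m-1}}maxPr_S(i_m).$$ *)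

theory Defs
  imports Complex_Main
begin

type_synonym 'i pattern = "'i set list"

text \<open>An event of an uncertain sequence maps each item it contains to the existential
  probability of that item occurrence; its itemset is the domain of the map.\<close>

type_synonym 'i uevent = "'i \<rightharpoonup> real"
type_synonym 'i usequence = "'i uevent list"

definition sequential_pattern :: "'i pattern \<Rightarrow> bool" where
  "sequential_pattern \<alpha> \<longleftrightarrow> (\<forall>X\<in>set \<alpha>. X \<noteq> {})"

definition uncertain_sequence :: "'i usequence \<Rightarrow> bool" where
  "uncertain_sequence S \<longleftrightarrow> (\<forall>e\<in>set S. dom e \<noteq> {} \<and> (\<forall>p\<in>ran e. 0 < p \<and> p \<le> 1))"

definition uncertain_database :: "'i usequence list \<Rightarrow> bool" where
  "uncertain_database DB \<longleftrightarrow> (\<forall>S\<in>set DB. uncertain_sequence S)"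

definition pattern_length :: "'i pattern \<Rightarrow> nat" where
  "pattern_length \<alpha> = (\<Sum>X\<leftarrow>\<alpha>. card X)"

definition pattern_items :: "'i::linorder pattern \<Rightarrow> 'i list" where
  "pattern_items \<alpha> = concat (map sorted_list_of_set \<alpha>)"

text \<open>The pattern formed by the first \<open>k\<close> items, a last event being cut if necessary.\<close>

fun pattern_prefix :: "nat \<Rightarrow> 'i::linorder pattern \<Rightarrow> 'i pattern" where
  "pattern_prefix k [] = []"
| "pattern_prefix k (X # Xs) =
    (if k = 0 then []
     else if k < card X then [set (take k (sorted_list_of_set X))]
     else X # pattern_prefix (k - card X) Xs)"

definition max_or_zero :: "real set \<Rightarrow> real" where
  "max_or_zero A = (if A = {} then 0 else Max A)"

text \<open>Event indices are counted from 0.\<close>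

definition occurrences :: "'i pattern \<Rightarrow> 'i usequence \<Rightarrow> nat list set" where
  "occurrences \<alpha> S = {js. length js = length \<alpha> \<and> sorted_wrt (<) js \<and>
     (\<forall>l<length \<alpha>. js ! l < length S \<and> \<alpha> ! l \<subseteq> dom (S ! (js ! l)))}"

definition occurrence_prob :: "'i pattern \<Rightarrow> 'i usequence \<Rightarrow> nat list \<Rightarrow> real" where
  "occurrence_prob \<alpha> S js = (\<Prod>l<length \<alpha>. \<Prod>x\<in>\<alpha> ! l. the ((S ! (js ! l)) x))"

definition max_pr_seq :: "'i usequence \<Rightarrow> 'i pattern \<Rightarrow> real" where
  "max_pr_seq S \<alpha> = max_or_zero (occurrence_prob \<alpha> S ` occurrences \<alpha> S)"

definition exp_sup :: "'i usequence list \<Rightarrow> 'i pattern \<Rightarrow> real" where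
  "exp_sup DB \<alpha> = (\<Sum>S\<leftarrow>DB. max_pr_seq S \<alpha>)"

definition contains_pattern :: "'i usequence \<Rightarrow> 'i pattern \<Rightarrow> bool" where
  "contains_pattern S \<beta> \<longleftrightarrow> occurrences \<beta> S \<noteq> {}"

definition leftmost_end :: "'i pattern \<Rightarrow> 'i usequence \<Rightarrow> nat" where
  "leftmost_end \<beta> S = (LEAST t. contains_pattern (take t S) \<beta>)"

text \<open>A projected suffix is kept as a pair: what remains of the event in which the leftmost
  match ends, and the list of the later events. As indices start at 0, that event is
  \<open>S ! (t - 1)\<close>; for the empty pattern \<open>t = 0\<close>, nothing remains of a matched event,
  and the later events are all of \<open>S\<close>.\<close>

type_synonym 'i suffix = "'i uevent \<times> 'i uevent list"

definition project_sequence :: "'i::linorder pattern \<Rightarrow> 'i usequence \<Rightarrow> 'i suffix" where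
  "project_sequence \<beta> S =
    (let t = leftmost_end \<beta> S in
      (if \<beta> = [] then Map.empty else (S ! (t - 1)) |` {x. last (pattern_items \<beta>) < x},
       drop t S))"

definition project_database :: "'i::linorder usequence list \<Rightarrow> 'i pattern \<Rightarrow> 'i suffix list" where
  "project_database DB \<beta> =
    map (project_sequence \<beta>) (filter (\<lambda>S. contains_pattern S \<beta>) DB)"

datatype extension = S_ext | I_ext

text \<open>Appending \<open>i\<close> to \<open>\<beta>\<close> as a new event is the s-extension; the only other way to get the
  next prefix of a pattern is to add \<open>i\<close> to the last event of \<open>\<beta>\<close>
  (lemma \<open>pattern_prefix_step\<close> below).\<close>

definition extension_type :: "'i pattern \<Rightarrow> 'i \<Rightarrow> 'i pattern \<Rightarrow> extension" where
  "extension_type \<beta> i \<gamma> = (if \<gamma> = \<beta> @ [{i}] then S_ext else I_ext)"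

text \<open>The probabilities of the occurrences of \<open>i\<close> in a suffix that are counted as an extension
  of \<open>\<beta>\<close> of the given type.\<close>

fun counted_probs :: "extension \<Rightarrow> 'i pattern \<Rightarrow> 'i \<Rightarrow> 'i suffix \<Rightarrow> real set" where
  "counted_probs S_ext \<beta> i (r, es) = {p. \<exists>e\<in>set es. e i = Some p}"
| "counted_probs I_ext \<beta> i (r, es) =
    {p. r i = Some p} \<union> {p. \<exists>e\<in>set es. last \<beta> \<union> {i} \<subseteq> dom e \<and> e i = Some p}"

text \<open>In the following, the considered item is the \<open>k\<close>-th one (\<open>k \<ge> 1\<close>) of \<open>\<alpha>\<close>, and the
  sets of counted probabilities refer to the projection along the first \<open>k - 1\<close> items.\<close>

definition step_probs :: "'i::linorder pattern \<Rightarrow> nat \<Rightarrow> 'i suffix \<Rightarrow> real set" where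
  "step_probs \<alpha> k s =
    (let \<beta> = pattern_prefix (k - 1) \<alpha>; i = pattern_items \<alpha> ! (k - 1)
     in counted_probs (extension_type \<beta> i (pattern_prefix k \<alpha>)) \<beta> i s)"

definition P_hat :: "'i::linorder usequence list \<Rightarrow> 'i pattern \<Rightarrow> nat \<Rightarrow> real" where
  "P_hat DB \<alpha> k =
    max_or_zero (\<Union>s\<in>set (project_database DB (pattern_prefix (k - 1) \<alpha>)). step_probs \<alpha> k s)"

definition max_pr :: "'i::linorder usequence list \<Rightarrow> 'i pattern \<Rightarrow> nat \<Rightarrow> real" where
  "max_pr DB \<alpha> k = (\<Prod>l=1..k. P_hat DB \<alpha> l)"

definition exp_sup_cap :: "'i::linorder usequence list \<Rightarrow> 'i pattern \<Rightarrow> real" where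
  "exp_sup_cap DB \<alpha> =
    (let m = pattern_length \<alpha> in
      max_pr DB \<alpha> (m - 1) *
      (\<Sum>s\<leftarrow>project_database DB (pattern_prefix (m - 1) \<alpha>). max_or_zero (step_probs \<alpha> m s)))"

lemma pattern_prefix_all:
  "pattern_prefix (pattern_length \<alpha>) \<alpha> = (\<alpha> :: 'i::{finite,linorder} pattern)"
  if "sequential_pattern \<alpha>"
  using that
  by (induction \<alpha>) (auto simp: pattern_length_def sequential_pattern_def)

lemma pattern_prefix_step:
  fixes \<alpha> :: "'i::{finite,linorder} pattern"
  assumes "sequential_pattern \<alpha>" and "1 \<le> k" and "k \<le> pattern_length \<alpha>"
  shows "pattern_prefix k \<alpha> = pattern_prefix (k - 1) \<alpha> @ [{pattern_items \<alpha> ! (k - 1)}] \<or>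
    pattern_prefix (k - 1) \<alpha> \<noteq> [] \<and>
    pattern_prefix k \<alpha> = butlast (pattern_prefix (k - 1) \<alpha>) @
      [last (pattern_prefix (k - 1) \<alpha>) \<union> {pattern_items \<alpha> ! (k - 1)}]"
  using assms
proof (induction \<alpha> arbitrary: k)
  case Nil
  then show ?case by (simp add: pattern_length_def)
next
  case (Cons X Xs)
  let ?L = "sorted_list_of_set X"
  have L: "length ?L = card X" "set ?L = X" by simp_all
  have pos: "card X > 0"
    using Cons.prems(1) by (simp add: sequential_pattern_def card_gt_0_iff)
  show ?case
  proof (cases "k \<le> card X")
    case True
    then have lt: "k - 1 < length ?L" using Cons.prems(2) L(1) by simp
    have item: "pattern_items (X # Xs) ! (k - 1) = ?L ! (k - 1)"
      using lt by (simp add: pattern_items_def nth_append)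
    have "take (Suc (k - 1)) ?L = take (k - 1) ?L @ [?L ! (k - 1)]"
      using lt by (rule take_Suc_conv_app_nth)
    then have tk: "set (take k ?L) = set (take (k - 1) ?L) \<union> {?L ! (k - 1)}"
      using Cons.prems(2) by simp
    have nil: "pattern_prefix 0 Xs = []" by (cases Xs) auto
    have whole: "pattern_prefix k (X # Xs) = [set (take k ?L)]"
      using True Cons.prems(2) L nil by (auto simp: not_less)
    show ?thesis
    proof (cases "k = 1")
      case True
      then show ?thesis using whole tk item by simp
    next
      case False
      then have "pattern_prefix (k - 1) (X # Xs) = [set (take (k - 1) ?L)]"
        using True Cons.prems(2) by auto
      then show ?thesis using whole tk item by simp
    qed
  next
    case False
    then have k: "1 \<le> k - card X" "k - card X \<le> pattern_length Xs"
      using Cons.prems(3) by (auto simp: pattern_length_def)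
    have seq: "sequential_pattern Xs"
      using Cons.prems(1) by (simp add: sequential_pattern_def)
    have "pattern_items (X # Xs) ! (k - 1) = pattern_items Xs ! (k - card X - 1)"
    proof -
      have "\<not> k - 1 < card X" and "k - 1 - card X = k - card X - 1" using False by auto
      then show ?thesis by (simp add: pattern_items_def nth_append)
    qed
    moreover have "pattern_prefix k (X # Xs) = X # pattern_prefix (k - card X) Xs"
      using False Cons.prems(2) by simp
    moreover have "pattern_prefix (k - 1) (X # Xs) = X # pattern_prefix (k - card X - 1) Xs"
    proof -
      have "\<not> k - 1 < card X" and "k - 1 - card X = k - card X - 1" and "k - 1 \<noteq> 0"
        using False pos by auto
      then show ?thesis by simp
    qed
    ultimately show ?thesis
      using Cons.IH[OF seq k] by auto
  qed
qed

end

theory Submission imports Defs begin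

text \<open>Fix an occurrence of \<open>\<alpha>\<close> in \<open>S\<close>. It restricts to an occurrence of every prefix
  \<open>\<alpha>\<^sub>k\<^sub>-\<^sub>1\<close>, and this restriction ends no earlier than the leftmost match of \<open>\<alpha>\<^sub>k\<^sub>-\<^sub>1\<close>. Hence
  the item occurrence used for \<open>i\<^sub>k\<close> survives in the projected suffix and is counted there with
  the right extension type. So each factor of the probability of the occurrence but the last is at
  most the corresponding \<open>P_hat\<close>, and the last one is at most the maximum over the suffix
  of \<open>S\<close> itself.\<close>

section \<open>Maxima with default value 0 and basic facts on occurrences\<close>

lemma max_or_zero_upper: "finite A \<Longrightarrow> x \<in> A \<Longrightarrow> x \<le> max_or_zero A"
  by (auto simp: max_or_zero_def)

lemma max_or_zero_nonneg: "finite A \<Longrightarrow> (\<And>x. x \<in> A \<Longrightarrow> 0 \<le> x) \<Longrightarrow> 0 \<le> max_or_zero A"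
  by (auto simp: max_or_zero_def)

lemma nth_in_set_drop: "n \<le> j \<Longrightarrow> j < length xs \<Longrightarrow> xs ! j \<in> set (drop n xs)"
  by (auto simp: in_set_conv_nth intro!: exI[of _ "j - n"])

lemma finite_occurrences: "finite (occurrences \<alpha> S)"
proof (rule finite_subset)
  show "occurrences \<alpha> S \<subseteq> {js. set js \<subseteq> {..<length S} \<and> length js = length \<alpha>}"
    by (auto simp: occurrences_def in_set_conv_nth)
  show "finite {js. set js \<subseteq> {..<length S} \<and> length js = length \<alpha>}"
    by (intro finite_lists_length_eq) simp
qed

lemma occurrence_less_length: "js \<in> occurrences \<beta> S \<Longrightarrow> j \<in> set js \<Longrightarrow> j < length S"
  by (auto simp: occurrences_def in_set_conv_nth)

text \<open>An occurrence whose indices are all below \<open>n\<close> already lies in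
  \<open>take n S\<close>, which makes \<open>n\<close> a candidate for the minimum. The free bound
  \<open>n\<close>, in place of the successor of the last index, also covers the empty
  pattern.\<close>

lemma leftmost_end_le:
  assumes "js \<in> occurrences \<beta> S" and "\<And>j. j \<in> set js \<Longrightarrow> j < n"
  shows "leftmost_end \<beta> S \<le> n"
proof -
  have "js ! l < n" if "l < length \<beta>" for l
    using assms that by (auto simp: occurrences_def)
  then have "js \<in> occurrences \<beta> (take n S)"
    using assms(1) by (auto simp: occurrences_def)
  then have "contains_pattern (take n S) \<beta>"
    by (auto simp: contains_pattern_def)
  then show ?thesis
    unfolding leftmost_end_def by (rule Least_le)
qed

lemma occurrences_snoc:
  "js @ [j] \<in> occurrences (\<beta> @ [X]) S \<longleftrightarrow>
    js \<in> occurrences \<beta> S \<and> (\<forall>j'\<in>set js. j' < j) \<and> j < length S \<and> X \<subseteq> dom (S ! j)"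
  by (auto simp: occurrences_def sorted_wrt_append nth_append less_Suc_eq all_conj_distrib)

lemma occurrences_snocE:
  assumes "js \<in> occurrences (\<beta> @ [X]) S"
  obtains js' j where "js = js' @ [j]"
  using assms by (cases js rule: rev_cases) (auto simp: occurrences_def)

lemma occurrence_prob_snoc:
  assumes "js \<in> occurrences \<beta> S"
  shows "occurrence_prob (\<beta> @ [X]) S (js @ [j]) =
    occurrence_prob \<beta> S js * (\<Prod>x\<in>X. the ((S ! j) x))"
  using assms by (auto simp: occurrence_prob_def occurrences_def nth_append intro!: prod.cong)

section \<open>One extension step along a fixed occurrence\<close>

text \<open>Dropping the last index \<open>j\<close> leaves an occurrence of \<open>\<beta>\<close>
  inside the first \<open>j\<close> events. The leftmost match therefore needs at most
  \<open>j\<close> events, and \<open>S ! j\<close>, indexed from 0, is among the later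
  ones.\<close>

lemma s_extension_counted:
  assumes "js \<in> occurrences (\<beta> @ [{i}]) S"
  shows "\<exists>js'\<in>occurrences \<beta> S. \<exists>p\<in>counted_probs S_ext \<beta> i (project_sequence \<beta> S).
    occurrence_prob (\<beta> @ [{i}]) S js = occurrence_prob \<beta> S js' * p"
proof -
  obtain js' j where js: "js = js' @ [j]"
    using assms by (rule occurrences_snocE)
  then have occ: "js' \<in> occurrences \<beta> S" and "\<forall>j'\<in>set js'. j' < j"
    and j: "j < length S" and i: "i \<in> dom (S ! j)"
    using assms by (auto simp: occurrences_snoc)
  then have "leftmost_end \<beta> S \<le> j"
    by (intro leftmost_end_le) auto
  then have "S ! j \<in> set (drop (leftmost_end \<beta> S) S)"
    using j by (intro nth_in_set_drop) auto
  then have "the ((S ! j) i) \<in> counted_probs S_ext \<beta> i (project_sequence \<beta> S)"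
    using i by (force simp: project_sequence_def Let_def)
  then show ?thesis
    using occ js by (auto simp: occurrence_prob_snoc)
qed

text \<open>The same index list serves the shorter pattern, as only the last itemset shrinks. If the
  leftmost match ends in \<open>S ! j\<close>, the item \<open>i\<close> remains there because it
  exceeds all of \<open>X\<close>; otherwise \<open>S ! j\<close> is a later event containing
  \<open>X \<union> {i}\<close>.\<close>

lemma i_extension_counted:
  fixes S :: "'i::{finite,linorder} usequence"
  assumes js: "js \<in> occurrences (\<beta> @ [X \<union> {i}]) S"
    and X: "X \<noteq> {}" "\<And>x. x \<in> X \<Longrightarrow> x < i"
  shows "\<exists>js'\<in>occurrences (\<beta> @ [X]) S.
    \<exists>p\<in>counted_probs I_ext (\<beta> @ [X]) i (project_sequence (\<beta> @ [X]) S).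
    occurrence_prob (\<beta> @ [X \<union> {i}]) S js = occurrence_prob (\<beta> @ [X]) S js' * p"
proof -
  obtain js' j where js': "js = js' @ [j]"
    using js by (rule occurrences_snocE)
  from js have "js' \<in> occurrences \<beta> S \<and> (\<forall>j'\<in>set js'. j' < j) \<and> j < length S \<and>
      X \<union> {i} \<subseteq> dom (S ! j)"
    unfolding js' occurrences_snoc .
  then have occ': "js' \<in> occurrences \<beta> S" and lt: "\<forall>j'\<in>set js'. j' < j"
    and j: "j < length S" and Xi: "X \<union> {i} \<subseteq> dom (S ! j)"
    by simp_all
  then have occ: "js \<in> occurrences (\<beta> @ [X]) S"
    by (auto simp: js' occurrences_snoc)
  let ?t = "leftmost_end (\<beta> @ [X]) S"
  have t: "?t \<le> Suc j"
    using occ lt by (intro leftmost_end_le) (auto simp: js' less_Suc_eq)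
  obtain p where p: "(S ! j) i = Some p"
    using Xi by auto
  have counted: "p \<in> counted_probs I_ext (\<beta> @ [X]) i (project_sequence (\<beta> @ [X]) S)"
  proof (cases "?t = Suc j")
    case True
    \<comment> \<open>As \<open>X\<close> is nonempty, the last item of the pattern lies in
      \<open>X\<close>, hence below \<open>i\<close>. So the restriction of
      \<open>S ! (?t - 1)\<close>, which is \<open>S ! j\<close>, keeps \<open>i\<close>.\<close>
    have "sorted_list_of_set X \<noteq> []"
      using X(1) by simp
    then have "last (pattern_items (\<beta> @ [X])) \<in> X"
      using last_in_set[of "sorted_list_of_set X"] by (simp add: pattern_items_def)
    then show ?thesis
      using True p X(2) by (simp add: project_sequence_def Let_def)
  next
    case False
    then have "S ! j \<in> set (drop ?t S)"
      using t j by (intro nth_in_set_drop) auto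
    then show ?thesis
      using p Xi by (auto simp: project_sequence_def Let_def)
  qed
  \<comment> \<open>This lets the product over \<open>X \<union> {i}\<close> split off exactly one
    factor \<open>p\<close>.\<close>
  have "i \<notin> X"
    using X(2) by blast
  then have "occurrence_prob (\<beta> @ [X \<union> {i}]) S js = occurrence_prob (\<beta> @ [X]) S js * p"
    using p by (simp add: js' occurrence_prob_snoc[OF occ'])
  then show ?thesis
    using occ counted by blast
qed

section \<open>Items of pattern prefixes\<close>

text \<open>In a cut event the kept items form an initial part of a sorted list without repetition,
  so sorting their set returns the same list.\<close>

lemma pattern_items_prefix:
  fixes \<alpha> :: "'i::{finite,linorder} pattern"
  shows "pattern_items (pattern_prefix k \<alpha>) = take k (pattern_items \<alpha>)"
proof (induction \<alpha> arbitrary: k)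
  case Nil
  then show ?case by (simp add: pattern_items_def)
next
  case (Cons X Xs)
  have "sorted_list_of_set (set (take k (sorted_list_of_set X))) = take k (sorted_list_of_set X)"
    by (intro sorted_distinct_set_unique)
      (auto intro: sorted_wrt_take strict_sorted_imp_sorted)
  then show ?case
    using Cons.IH by (auto simp: pattern_items_def)
qed

lemma length_pattern_items:
  "length (pattern_items (\<alpha> :: 'i::{finite,linorder} pattern)) = pattern_length \<alpha>"
  by (induction \<alpha>) (auto simp: pattern_items_def pattern_length_def)

lemma sequential_pattern_prefix:
  fixes \<alpha> :: "'i::{finite,linorder} pattern"
  shows "sequential_pattern \<alpha> \<Longrightarrow> sequential_pattern (pattern_prefix k \<alpha>)"
  by (induction k \<alpha> rule: pattern_prefix.induct)
    (auto simp: sequential_pattern_def card_gt_0_iff)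

text \<open>Refines \<open>pattern_prefix_step\<close>: in the second case the new item exceeds the
  whole last event, an order on which \<open>i_extension_counted\<close> depends.\<close>

lemma pattern_prefix_cases:
  fixes \<alpha> :: "'i::{finite,linorder} pattern"
  assumes "sequential_pattern \<alpha>" and "1 \<le> k" and "k \<le> pattern_length \<alpha>"
  obtains (S_ext)
      "pattern_prefix k \<alpha> = pattern_prefix (k - 1) \<alpha> @ [{pattern_items \<alpha> ! (k - 1)}]"
    | (I_ext) \<beta> X where "pattern_prefix (k - 1) \<alpha> = \<beta> @ [X]"
      and "pattern_prefix k \<alpha> = \<beta> @ [X \<union> {pattern_items \<alpha> ! (k - 1)}]"
      and "X \<noteq> {}" and "\<And>x. x \<in> X \<Longrightarrow> x < pattern_items \<alpha> ! (k - 1)"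
  using pattern_prefix_step[OF assms]
proof (elim disjE conjE)
  assume "pattern_prefix k \<alpha> = pattern_prefix (k - 1) \<alpha> @ [{pattern_items \<alpha> ! (k - 1)}]"
  then show thesis by (rule S_ext)
next
  let ?i = "pattern_items \<alpha> ! (k - 1)"
  assume ne: "pattern_prefix (k - 1) \<alpha> \<noteq> []"
    and \<gamma>: "pattern_prefix k \<alpha> = butlast (pattern_prefix (k - 1) \<alpha>) @
      [last (pattern_prefix (k - 1) \<alpha>) \<union> {?i}]"
  define \<beta> where "\<beta> = butlast (pattern_prefix (k - 1) \<alpha>)"
  define X where "X = last (pattern_prefix (k - 1) \<alpha>)"
  have pre: "pattern_prefix (k - 1) \<alpha> = \<beta> @ [X]"
    using ne by (simp add: \<beta>_def X_def)
  have post: "pattern_prefix k \<alpha> = \<beta> @ [X \<union> {?i}]"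
    using \<gamma> by (simp add: \<beta>_def X_def)
  have "X \<noteq> {}"
    using sequential_pattern_prefix[OF assms(1), of "k - 1"] pre
    by (simp add: sequential_pattern_def)
  \<comment> \<open>The order comes from comparing the item lists of two consecutive prefixes: after
    cancelling the items of \<open>\<beta>\<close>, the sorted list of
    \<open>X \<union> {?i}\<close> ends in \<open>?i\<close>.\<close>
  have "take k (pattern_items \<alpha>) = take (k - 1) (pattern_items \<alpha>) @ [?i]"
    using assms(2,3) take_Suc_conv_app_nth[of "k - 1" "pattern_items \<alpha>"]
    by (simp add: length_pattern_items)
  then have "pattern_items (\<beta> @ [X \<union> {?i}]) = pattern_items (\<beta> @ [X]) @ [?i]"
    by (simp only: pattern_items_prefix[symmetric] pre post)
  then have "sorted_list_of_set (X \<union> {?i}) = sorted_list_of_set X @ [?i]"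
    by (simp add: pattern_items_def)
  then have "sorted_wrt (<) (sorted_list_of_set X @ [?i])"
    by (metis strict_sorted_list_of_set)
  then have "\<And>x. x \<in> X \<Longrightarrow> x < ?i"
    by (simp add: sorted_wrt_append)
  with pre post \<open>X \<noteq> {}\<close> show thesis by (rule I_ext)
qed

lemma occurrence_prob_step:
  fixes \<alpha> :: "'i::{finite,linorder} pattern"
  assumes "sequential_pattern \<alpha>" and "1 \<le> k" and "k \<le> pattern_length \<alpha>"
    and js: "js \<in> occurrences (pattern_prefix k \<alpha>) S"
  shows "\<exists>js'\<in>occurrences (pattern_prefix (k - 1) \<alpha>) S.
    \<exists>p\<in>step_probs \<alpha> k (project_sequence (pattern_prefix (k - 1) \<alpha>) S).
    occurrence_prob (pattern_prefix k \<alpha>) S js =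
      occurrence_prob (pattern_prefix (k - 1) \<alpha>) S js' * p"
  using assms(1-3)
proof (cases rule: pattern_prefix_cases)
  case S_ext
  then show ?thesis
    using s_extension_counted js by (simp add: step_probs_def Let_def extension_type_def)
next
  case (I_ext \<beta> X)
  \<comment> \<open>The prefix has one event fewer than the s-extension would have, so
    \<open>extension_type\<close> yields \<open>I_ext\<close>.\<close>
  then show ?thesis
    using i_extension_counted[of js \<beta> X "pattern_items \<alpha> ! (k - 1)" S] js
    by (simp add: step_probs_def Let_def extension_type_def)
qed

section \<open>Finiteness and sign of the counted probabilities\<close>

text \<open>Projection only restricts and drops events, so finiteness and sign are inherited from
  \<open>S\<close>. Containment of \<open>\<beta>\<close> keeps \<open>leftmost_end\<close> within
  the length of \<open>S\<close>, so that the matched event is a genuine event of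
  \<open>S\<close>.\<close>

lemma counted_probs_subset:
  assumes "contains_pattern S \<beta>"
  shows "counted_probs ty \<beta> i (project_sequence \<beta> S) \<subseteq> {p. \<exists>e\<in>set S. e i = Some p}"
proof -
  obtain js where js: "js \<in> occurrences \<beta> S"
    using assms by (auto simp: contains_pattern_def)
  have "leftmost_end \<beta> S \<le> length S"
    using js by (intro leftmost_end_le) (auto dest: occurrence_less_length)
  moreover have "S \<noteq> []" if "\<beta> \<noteq> []"
    using js that by (auto simp: occurrences_def)
  \<comment> \<open>Subtraction is truncated, so the index is valid even if
    \<open>leftmost_end\<close> were 0, once \<open>S\<close> is nonempty.\<close>
  ultimately have "S ! (leftmost_end \<beta> S - 1) \<in> set S" if "\<beta> \<noteq> []"
    using that by (intro nth_mem) (cases S; auto)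
  then show ?thesis
    by (cases ty)
      (auto simp: project_sequence_def Let_def restrict_map_def split: if_splits dest: in_set_dropD)
qed

lemma
  assumes "contains_pattern S (pattern_prefix (k - 1) \<alpha>)"
  shows finite_step_probs:
      "finite (step_probs \<alpha> k (project_sequence (pattern_prefix (k - 1) \<alpha>) S))"
    and step_probs_nonneg: "uncertain_sequence S \<Longrightarrow>
      p \<in> step_probs \<alpha> k (project_sequence (pattern_prefix (k - 1) \<alpha>) S) \<Longrightarrow> 0 \<le> p"
proof -
  let ?A = "{p. \<exists>e\<in>set S. e (pattern_items \<alpha> ! (k - 1)) = Some p}"
  have sub: "step_probs \<alpha> k (project_sequence (pattern_prefix (k - 1) \<alpha>) S) \<subseteq> ?A"
    using counted_probs_subset[OF assms] by (simp add: step_probs_def Let_def)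
  have "?A \<subseteq> (\<lambda>e. the (e (pattern_items \<alpha> ! (k - 1)))) ` set S"
    by force
  with sub show "finite (step_probs \<alpha> k (project_sequence (pattern_prefix (k - 1) \<alpha>) S))"
    by (meson finite_subset finite_imageI finite_set)
  show "0 \<le> p" if "uncertain_sequence S"
    and "p \<in> step_probs \<alpha> k (project_sequence (pattern_prefix (k - 1) \<alpha>) S)"
    using that sub by (auto simp: uncertain_sequence_def dest!: subsetD) (meson less_imp_le ranI)
qed

lemma set_project_database:
  "set (project_database DB \<beta>) = project_sequence \<beta> ` {S \<in> set DB. contains_pattern S \<beta>}"
  by (auto simp: project_database_def)

lemma finite_database_step_probs:
  "finite (\<Union>s\<in>set (project_database DB (pattern_prefix (k - 1) \<alpha>)). step_probs \<alpha> k s)"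
  unfolding set_project_database by (auto intro: finite_step_probs simp del: One_nat_def)

lemma P_hat_nonneg: "uncertain_database DB \<Longrightarrow> 0 \<le> P_hat DB \<alpha> k"
  unfolding P_hat_def using finite_database_step_probs
  by (rule max_or_zero_nonneg)
    (auto simp: set_project_database uncertain_database_def simp del: One_nat_def
      dest: step_probs_nonneg)

lemma P_hat_upper:
  assumes "S \<in> set DB" and "contains_pattern S (pattern_prefix (k - 1) \<alpha>)"
    and "p \<in> step_probs \<alpha> k (project_sequence (pattern_prefix (k - 1) \<alpha>) S)"
  shows "p \<le> P_hat DB \<alpha> k"
  unfolding P_hat_def using finite_database_step_probs
  by (rule max_or_zero_upper) (use assms in \<open>auto simp: set_project_database\<close>)

lemma max_pr_nonneg: "uncertain_database DB \<Longrightarrow> 0 \<le> max_pr DB \<alpha> k"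
  unfolding max_pr_def by (simp add: prod_nonneg P_hat_nonneg)

section \<open>Bounds for a single sequence and their sum\<close>

text \<open>Induction peels off one item at a time. Since \<open>S\<close> contains the shorter
  prefix, its suffix takes part in the maximum \<open>P_hat\<close>; nonnegativity allows the two
  bounds to be multiplied.\<close>

lemma occurrence_prob_le_max_pr:
  fixes \<alpha> :: "'i::{finite,linorder} pattern"
  assumes DB: "uncertain_database DB" "S \<in> set DB" and "sequential_pattern \<alpha>"
    and "k \<le> pattern_length \<alpha>" and "js \<in> occurrences (pattern_prefix k \<alpha>) S"
  shows "occurrence_prob (pattern_prefix k \<alpha>) S js \<le> max_pr DB \<alpha> k"
  using assms(4,5)
proof (induction k arbitrary: js)
  case 0
  have "pattern_prefix 0 \<alpha> = []"
    by (cases \<alpha>) auto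
  then show ?case
    by (simp add: max_pr_def occurrence_prob_def)
next
  case (Suc k)
  obtain js' p where js': "js' \<in> occurrences (pattern_prefix k \<alpha>) S"
    and p: "p \<in> step_probs \<alpha> (Suc k) (project_sequence (pattern_prefix k \<alpha>) S)"
    and eq: "occurrence_prob (pattern_prefix (Suc k) \<alpha>) S js =
      occurrence_prob (pattern_prefix k \<alpha>) S js' * p"
    using occurrence_prob_step[OF assms(3) _ Suc.prems] by auto
  have "contains_pattern S (pattern_prefix k \<alpha>)"
    using js' by (auto simp: contains_pattern_def)
  then have "0 \<le> p" and "p \<le> P_hat DB \<alpha> (Suc k)"
    using DB p step_probs_nonneg[of S "Suc k" \<alpha>] P_hat_upper[of S DB "Suc k" \<alpha>]
    by (auto simp: uncertain_database_def)
  moreover have "occurrence_prob (pattern_prefix k \<alpha>) S js' \<le> max_pr DB \<alpha> k"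
    using Suc js' by simp
  ultimately have "occurrence_prob (pattern_prefix k \<alpha>) S js' * p
      \<le> max_pr DB \<alpha> k * P_hat DB \<alpha> (Suc k)"
    using DB(1) by (intro mult_mono) (simp_all add: max_pr_nonneg)
  then show ?case
    by (simp add: eq max_pr_def)
qed

text \<open>The last factor is bounded by the maximum over the suffix of \<open>S\<close> alone, as
  \<open>exp_sup_cap\<close> requires. The value 0 for sequences without \<open>\<beta>\<close> lets
  the bound be summed over all of \<open>DB\<close>.\<close>

lemma max_pr_seq_le:
  fixes \<alpha> :: "'i::{finite,linorder} pattern"
  defines "m \<equiv> pattern_length \<alpha>"
  defines "\<beta> \<equiv> pattern_prefix (m - 1) \<alpha>"
  assumes DB: "uncertain_database DB" "S \<in> set DB" and \<alpha>: "sequential_pattern \<alpha>" and m: "1 \<le> m"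
  shows "max_pr_seq S \<alpha> \<le> max_pr DB \<alpha> (m - 1) *
    (if contains_pattern S \<beta> then max_or_zero (step_probs \<alpha> m (project_sequence \<beta> S)) else 0)"
    (is "_ \<le> ?R")
proof -
  \<comment> \<open>Covers the case that \<open>\<alpha>\<close> has no occurrence in
    \<open>S\<close>, where \<open>max_pr_seq\<close> takes its default 0.\<close>
  have "0 \<le> ?R"
    using DB max_pr_nonneg[OF DB(1)] finite_step_probs[of S m \<alpha>] step_probs_nonneg[of S m \<alpha>]
    by (auto simp: \<beta>_def uncertain_database_def intro!: mult_nonneg_nonneg max_or_zero_nonneg)
  moreover have "occurrence_prob \<alpha> S js \<le> ?R" if js: "js \<in> occurrences \<alpha> S" for js
  proof -
    have all: "pattern_prefix m \<alpha> = \<alpha>"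
      unfolding m_def using \<alpha> by (rule pattern_prefix_all)
    obtain js' p where js': "js' \<in> occurrences \<beta> S"
      and p: "p \<in> step_probs \<alpha> m (project_sequence \<beta> S)"
      and eq: "occurrence_prob \<alpha> S js = occurrence_prob \<beta> S js' * p"
      using occurrence_prob_step[OF \<alpha> m[unfolded m_def] order_refl, of js S] all[unfolded m_def] js
      unfolding m_def \<beta>_def by auto
    have con: "contains_pattern S \<beta>"
      using js' by (auto simp: contains_pattern_def)
    have "0 \<le> p"
      using DB con p step_probs_nonneg[of S m \<alpha>] by (auto simp: \<beta>_def uncertain_database_def)
    moreover have "p \<le> max_or_zero (step_probs \<alpha> m (project_sequence \<beta> S))"
      using con p finite_step_probs[of S m \<alpha>] by (auto simp: \<beta>_def intro: max_or_zero_upper)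
    moreover have "occurrence_prob \<beta> S js' \<le> max_pr DB \<alpha> (m - 1)"
      using occurrence_prob_le_max_pr[OF DB \<alpha>, of "m - 1" js'] js' by (simp add: \<beta>_def m_def)
    ultimately show ?thesis
      using con DB(1) by (auto simp: eq max_pr_nonneg intro!: mult_mono)
  qed
  ultimately show ?thesis
    by (auto simp: max_pr_seq_def max_or_zero_def finite_occurrences)
qed

theorem lemma1:
  fixes DB :: "'i::{finite,linorder} usequence list" and \<alpha> :: "'i pattern"
  assumes "uncertain_database DB"
    and "sequential_pattern \<alpha>"
    and "pattern_length \<alpha> \<ge> 1"
  shows "exp_sup_cap DB \<alpha> \<ge> exp_sup DB \<alpha>"
proof -
  let ?m = "pattern_length \<alpha>"
  let ?\<beta> = "pattern_prefix (?m - 1) \<alpha>"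
  let ?g = "\<lambda>S. max_or_zero (step_probs \<alpha> ?m (project_sequence ?\<beta> S))"
  have "exp_sup DB \<alpha> \<le>
      (\<Sum>S\<leftarrow>DB. max_pr DB \<alpha> (?m - 1) * (if contains_pattern S ?\<beta> then ?g S else 0))"
    unfolding exp_sup_def using assms by (intro sum_list_mono max_pr_seq_le)
  \<comment> \<open>The summands set to 0 belong to the sequences that
    \<open>project_database\<close> filters out, and the common factor moves out of the sum.\<close>
  also have "\<dots> = exp_sup_cap DB \<alpha>"
    by (simp add: exp_sup_cap_def Let_def project_database_def sum_list_const_mult
        sum_list_map_filter' comp_def del: One_nat_def)
  finally show ?thesis .
qed

end
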